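(* Let $C$ be a groupoid and $Q$ a Dedekind quantale in which binary inf distributes over all sups. Then $Q^C$, with pointwise order and lattice operations, convolution $\ast$, unit $\mathit{id}_0$ and involution $f^\circ(x)=(f(x^-))^\circ$, is a Dedekind quantale in which binary inf distributes over all sups.
   Context: A catoid $(C,\odot,s,t)$ is a set with $\odot:C\times C\to\mathcal P C$ and $s,t:C\to C$ such that, with $X\odot Y=\bigcup_{x\in X,y\in Y}x\odot y$: $x\odot(y\odot z)=(x\odot y)\odot z$, $x\odot y\ne\emptyset\Rightarrow t(x)=s(y)$, $s(x)\odot x=\{x\}$, $x\odot t(x)=\{x\}$. A groupoid is a catoid with $(-)^-:C\to C$ such that $x\odot x^-=\{s(x)\}$ and $x^-\odot x=\{t(x)\}$. A quantale is a complete lattice with an associative multiplication preserving all sups in both arguments and having a unit $1$. An involutive quantale is a quantale with $(-)^\circ$ satisfying $\alpha^{\circ\circ}=\alpha$, $(\bigvee A)^\circ=\bigvee\{\alpha^\circ\mid\alpha\in A\}$, $(\alpha\beta)^\circ=\beta^\circ\alpha^\circ$. A Dedekind quantale is an involutive quantale satisfying $\alpha\beta\wedge\gamma\le(\alpha\wedge\gamma\beta^\circ)(\beta\wedge\alpha^\circ\gamma)$. Binary inf distributes over all sups means $\alpha\wedge\bigvee B=\bigvee\{\alpha\wedge\beta\mid\beta\in B\}$. On $Q^C$: $(f\ast g)(x)=\bigvee\{f(y)\cdot g(z)\mid x\in y\odot z\}$, and $\mathit{id}_0(x)=1$ if $s(x)=x$, $\bot$ otherwise. *)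

theory Defs
  imports "HOL-Algebra.Complete_Lattice" "HOL-Library.FuncSet"
begin

section \<open>Catoids and groupoids\<close>

record 'c catoid = "'c partial_object" +
  comp :: "'c \<Rightarrow> 'c \<Rightarrow> 'c set" (infixl \<open>\<odot>\<index>\<close> 70)
  src :: "'c \<Rightarrow> 'c"
  tgt :: "'c \<Rightarrow> 'c"

record 'c groupoid = "'c catoid" +
  ginv :: "'c \<Rightarrow> 'c"

definition comp_set :: "('c, 'm) catoid_scheme \<Rightarrow> 'c set \<Rightarrow> 'c set \<Rightarrow> 'c set"
  where "comp_set C X Y = (\<Union>x\<in>X. \<Union>y\<in>Y. x \<odot>\<^bsub>C\<^esub> y)"

locale catoid =
  fixes C :: "('c, 'm) catoid_scheme" (structure)
  assumes comp_closed: "\<lbrakk>x \<in> carrier C; y \<in> carrier C\<rbrakk> \<Longrightarrow> x \<odot> y \<subseteq> carrier C"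
    and src_closed: "x \<in> carrier C \<Longrightarrow> src C x \<in> carrier C"
    and tgt_closed: "x \<in> carrier C \<Longrightarrow> tgt C x \<in> carrier C"
    and comp_assoc: "\<lbrakk>x \<in> carrier C; y \<in> carrier C; z \<in> carrier C\<rbrakk>
      \<Longrightarrow> comp_set C {x} (y \<odot> z) = comp_set C (x \<odot> y) {z}"
    and comp_nonempty: "\<lbrakk>x \<in> carrier C; y \<in> carrier C; x \<odot> y \<noteq> {}\<rbrakk> \<Longrightarrow> tgt C x = src C y"
    and src_comp: "x \<in> carrier C \<Longrightarrow> src C x \<odot> x = {x}"
    and comp_tgt: "x \<in> carrier C \<Longrightarrow> x \<odot> tgt C x = {x}"

locale groupoid = catoid C for C :: "('c, 'm) groupoid_scheme" (structure) +
  assumes ginv_closed: "x \<in> carrier C \<Longrightarrow> ginv C x \<in> carrier C"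
    and comp_ginv: "x \<in> carrier C \<Longrightarrow> x \<odot> ginv C x = {src C x}"
    and ginv_comp: "x \<in> carrier C \<Longrightarrow> ginv C x \<odot> x = {tgt C x}"

section \<open>Quantales\<close>

record 'q quantale = "'q gorder" +
  qmult :: "'q \<Rightarrow> 'q \<Rightarrow> 'q" (infixl \<open>\<cdot>\<index>\<close> 75)
  qunit :: "'q"

record 'q inv_quantale = "'q quantale" +
  qstar :: "'q \<Rightarrow> 'q"

locale quantale = complete_lattice Q for Q :: "('q, 'm) quantale_scheme" (structure) +
  assumes qmult_closed: "\<lbrakk>a \<in> carrier Q; b \<in> carrier Q\<rbrakk> \<Longrightarrow> a \<cdot> b \<in> carrier Q"
    and qunit_closed: "qunit Q \<in> carrier Q"
    and qmult_assoc: "\<lbrakk>a \<in> carrier Q; b \<in> carrier Q; c \<in> carrier Q\<rbrakk>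
      \<Longrightarrow> (a \<cdot> b) \<cdot> c = a \<cdot> (b \<cdot> c)"
    and qunit_left: "a \<in> carrier Q \<Longrightarrow> qunit Q \<cdot> a = a"
    and qunit_right: "a \<in> carrier Q \<Longrightarrow> a \<cdot> qunit Q = a"
    and qmult_sup_right: "\<lbrakk>a \<in> carrier Q; B \<subseteq> carrier Q\<rbrakk>
      \<Longrightarrow> a \<cdot> (\<Squnion>B) = \<Squnion>{a \<cdot> b | b. b \<in> B}"
    and qmult_sup_left: "\<lbrakk>A \<subseteq> carrier Q; b \<in> carrier Q\<rbrakk>
      \<Longrightarrow> (\<Squnion>A) \<cdot> b = \<Squnion>{a \<cdot> b | a. a \<in> A}"

locale inv_quantale = quantale Q for Q :: "('q, 'm) inv_quantale_scheme" (structure) +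
  assumes qstar_closed: "a \<in> carrier Q \<Longrightarrow> qstar Q a \<in> carrier Q"
    and qstar_qstar: "a \<in> carrier Q \<Longrightarrow> qstar Q (qstar Q a) = a"
    and qstar_sup: "A \<subseteq> carrier Q \<Longrightarrow> qstar Q (\<Squnion>A) = \<Squnion>{qstar Q a | a. a \<in> A}"
    and qstar_qmult: "\<lbrakk>a \<in> carrier Q; b \<in> carrier Q\<rbrakk>
      \<Longrightarrow> qstar Q (a \<cdot> b) = qstar Q b \<cdot> qstar Q a"

locale dedekind_quantale = inv_quantale Q for Q :: "('q, 'm) inv_quantale_scheme" (structure) +
  assumes dedekind: "\<lbrakk>a \<in> carrier Q; b \<in> carrier Q; c \<in> carrier Q\<rbrakk>
      \<Longrightarrow> (a \<cdot> b) \<sqinter> c \<sqsubseteq> (a \<sqinter> (c \<cdot> qstar Q b)) \<cdot> (b \<sqinter> (qstar Q a \<cdot> c))"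

definition inf_distrib_sups :: "('q, 'm) gorder_scheme \<Rightarrow> bool"
  where "inf_distrib_sups L \<longleftrightarrow>
    (\<forall>a\<in>carrier L. \<forall>B. B \<subseteq> carrier L \<longrightarrow>
      a \<sqinter>\<^bsub>L\<^esub> (\<Squnion>\<^bsub>L\<^esub>B) = \<Squnion>\<^bsub>L\<^esub>{a \<sqinter>\<^bsub>L\<^esub> b | b. b \<in> B})"

section \<open>The convolution algebra\<close>

text \<open>
  Maps from the carrier of \<open>C\<close> to the carrier of \<open>Q\<close> are represented by extensional
  functions, so that equality of such maps is equality in HOL. The order is pointwise on the
  carrier of \<open>C\<close>; it determines the suprema and infima.
\<close>

definition conv ::
    "('c, 'm) catoid_scheme \<Rightarrow> ('q, 'n) quantale_scheme \<Rightarrow> ('c \<Rightarrow> 'q) \<Rightarrow> ('c \<Rightarrow> 'q) \<Rightarrow> 'c \<Rightarrow> 'q"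
  where "conv C Q f g = (\<lambda>x\<in>carrier C.
    \<Squnion>\<^bsub>Q\<^esub>{f y \<cdot>\<^bsub>Q\<^esub> g z | y z. y \<in> carrier C \<and> z \<in> carrier C \<and> x \<in> y \<odot>\<^bsub>C\<^esub> z})"

definition conv_id0 :: "('c, 'm) catoid_scheme \<Rightarrow> ('q, 'n) quantale_scheme \<Rightarrow> 'c \<Rightarrow> 'q"
  where "conv_id0 C Q = (\<lambda>x\<in>carrier C. if src C x = x then qunit Q else \<bottom>\<^bsub>Q\<^esub>)"

definition conv_star ::
    "('c, 'm) groupoid_scheme \<Rightarrow> ('q, 'n) inv_quantale_scheme \<Rightarrow> ('c \<Rightarrow> 'q) \<Rightarrow> 'c \<Rightarrow> 'q"
  where "conv_star C Q f = (\<lambda>x\<in>carrier C. qstar Q (f (ginv C x)))"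

definition conv_quantale ::
    "('c, 'm) groupoid_scheme \<Rightarrow> ('q, 'n) inv_quantale_scheme \<Rightarrow> ('c \<Rightarrow> 'q) inv_quantale"
  where "conv_quantale C Q =
    \<lparr>carrier = (carrier C \<rightarrow>\<^sub>E carrier Q),
     eq = (=),
     le = (\<lambda>f g. \<forall>x\<in>carrier C. f x \<sqsubseteq>\<^bsub>Q\<^esub> g x),
     qmult = conv C Q,
     qunit = conv_id0 C Q,
     qstar = conv_star C Q\<rparr>"

end

theory Submission
  imports Defs
begin

text \<open>
  In a groupoid, \<open>x \<in> y \<odot> z\<close> can be solved for either factor: it implies
  \<open>y \<in> x \<odot> z\<^sup>-\<close> and \<open>z \<in> y\<^sup>- \<odot> x\<close>. Hence \<open>h x \<cdot> (g z)\<^sup>\<circ>\<close> is one of the terms whose supremum is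
  \<open>(h \<ast> g\<^sup>\<circ>) y\<close>, and symmetrically for \<open>(f\<^sup>\<circ> \<ast> h) z\<close>. Distributing \<open>h x\<close> over the supremum
  defining \<open>(f \<ast> g) x\<close> and applying the Dedekind law of \<open>Q\<close> to each term therefore gives
  the Dedekind law of the convolution algebra. The equational laws are proved by
  indirect order: two elements agree when they have the same upper bounds, and the upper bounds
  of an iterated supremum are described by a universally quantified condition.
\<close>

section \<open>Catoids and groupoids\<close>

context catoid
begin

lemma mem_comp_closed: "\<lbrakk>w \<in> x \<odot> y; x \<in> carrier C; y \<in> carrier C\<rbrakk> \<Longrightarrow> w \<in> carrier C"
  using comp_closed by blast

lemma tgt_eq_src: "\<lbrakk>w \<in> x \<odot> y; x \<in> carrier C; y \<in> carrier C\<rbrakk> \<Longrightarrow> tgt C x = src C y"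
  using comp_nonempty by blast

text \<open>\<open>comp_assoc\<close> equates two unions. Reading one inclusion on a single
  composite lets later arguments rebracket one chosen element at a time; \<open>comp_assocD'\<close>
  reads the converse inclusion.\<close>

lemma comp_assocD:
  assumes "w \<in> x \<odot> v" "v \<in> y \<odot> z" "x \<in> carrier C" "y \<in> carrier C" "z \<in> carrier C"
  shows "\<exists>u. u \<in> x \<odot> y \<and> w \<in> u \<odot> z"
proof -
  have "w \<in> comp_set C {x} (y \<odot> z)"
    using assms by (auto simp: comp_set_def)
  then show ?thesis
    using assms by (auto simp: comp_assoc) (auto simp: comp_set_def)
qed

lemma comp_assocD':
  assumes "w \<in> u \<odot> z" "u \<in> x \<odot> y" "x \<in> carrier C" "y \<in> carrier C" "z \<in> carrier C"
  shows "\<exists>v. v \<in> y \<odot> z \<and> w \<in> x \<odot> v"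
proof -
  have "w \<in> comp_set C (x \<odot> y) {z}"
    using assms by (auto simp: comp_set_def)
  then show ?thesis
    using assms by (auto simp: comp_assoc[symmetric]) (auto simp: comp_set_def)
qed

text \<open>Both sides range over the ways to split \<open>x\<close> into three factors, and
  \<open>comp_assocD\<close> and \<open>comp_assocD'\<close> trade the intermediate element of one
  bracketing for one of the other. The upper bounds of a triple convolution have this shape.\<close>

lemma all_triple_factorizations_assoc:
  "(\<forall>y\<in>carrier C. \<forall>z\<in>carrier C. x \<in> y \<odot> z \<longrightarrow>
      (\<forall>u\<in>carrier C. \<forall>v\<in>carrier C. y \<in> u \<odot> v \<longrightarrow> P u v z)) \<longleftrightarrow>
    (\<forall>u\<in>carrier C. \<forall>w\<in>carrier C. x \<in> u \<odot> w \<longrightarrow>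
      (\<forall>v\<in>carrier C. \<forall>z\<in>carrier C. w \<in> v \<odot> z \<longrightarrow> P u v z))"
  (is "?l \<longleftrightarrow> ?r")
proof
  assume l: ?l
  show ?r
  proof (intro ballI impI)
    fix u w v z
    assume c: "u \<in> carrier C" "v \<in> carrier C" "z \<in> carrier C" and "x \<in> u \<odot> w" "w \<in> v \<odot> z"
    then obtain y where "y \<in> u \<odot> v" "x \<in> y \<odot> z"
      using comp_assocD by blast
    with l c show "P u v z"
      using mem_comp_closed by blast
  qed
next
  assume r: ?r
  show ?l
  proof (intro ballI impI)
    fix y z u v
    assume c: "u \<in> carrier C" "v \<in> carrier C" "z \<in> carrier C" and "x \<in> y \<odot> z" "y \<in> u \<odot> v"
    then obtain w where "w \<in> v \<odot> z" "x \<in> u \<odot> w"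
      using comp_assocD' by blast
    with r c show "P u v z"
      using mem_comp_closed by blast
  qed
qed

text \<open>The composite of \<open>src C x\<close> and \<open>x\<close> is nonempty, which forces
  the target of the first to be the source of the second.\<close>

lemma tgt_src: "x \<in> carrier C \<Longrightarrow> tgt C (src C x) = src C x"
  by (rule comp_nonempty) (simp_all add: src_closed src_comp)

lemma src_tgt: "x \<in> carrier C \<Longrightarrow> src C (tgt C x) = tgt C x"
  by (rule comp_nonempty[symmetric]) (simp_all add: tgt_closed comp_tgt)

text \<open>Rebracketing the left unit law \<open>w \<in> src C w \<odot> w\<close> along
  \<open>w \<in> x \<odot> y\<close> shows that \<open>src C w\<close> composes with
  \<open>x\<close>; \<open>tgt_src\<close> turns the resulting matching condition into the
  claim.\<close>

lemma src_mem_comp: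
  assumes "w \<in> x \<odot> y" "x \<in> carrier C" "y \<in> carrier C"
  shows "src C w = src C x"
proof -
  have w: "w \<in> carrier C" using assms by (rule mem_comp_closed)
  then have "w \<in> src C w \<odot> w" by (simp add: src_comp)
  from comp_assocD[OF this assms(1) src_closed[OF w] assms(2,3)]
  obtain u where "u \<in> src C w \<odot> x" by blast
  then show ?thesis
    using tgt_eq_src src_closed tgt_src w assms(2) by metis
qed

lemma tgt_mem_comp:
  assumes "w \<in> x \<odot> y" "x \<in> carrier C" "y \<in> carrier C"
  shows "tgt C w = tgt C y"
proof -
  have w: "w \<in> carrier C" using assms by (rule mem_comp_closed)
  then have "w \<in> w \<odot> tgt C w" by (simp add: comp_tgt)
  from comp_assocD'[OF this assms(1) assms(2,3) tgt_closed[OF w]]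
  obtain u where "u \<in> y \<odot> tgt C w" by blast
  then show ?thesis
    using tgt_eq_src tgt_closed src_tgt w assms(3) by metis
qed

text \<open>The left unit law makes \<open>x\<close> a composite with first factor
  \<open>src C x\<close>, so \<open>src_mem_comp\<close> applies.\<close>

lemma src_src: "x \<in> carrier C \<Longrightarrow> src C (src C x) = src C x"
  using src_mem_comp[of x "src C x" x] by (simp add: src_comp src_closed)

end

section \<open>Solving for factors by means of inverses\<close>

context groupoid
begin

lemma src_ginv: "x \<in> carrier C \<Longrightarrow> src C (ginv C x) = tgt C x"
  by (rule comp_nonempty[symmetric]) (simp_all add: ginv_closed comp_ginv)

lemma tgt_ginv: "x \<in> carrier C \<Longrightarrow> tgt C (ginv C x) = src C x"
  by (rule comp_nonempty) (simp_all add: ginv_closed ginv_comp)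

text \<open>In group notation, \<open>y\<^sup>- x = y\<^sup>- y z = z\<close>. As composition is
  set-valued, the composite is first shown to be inhabited; its element \<open>v\<close> then turns
  out to be \<open>z\<close>.\<close>

lemma solve_right:
  assumes "x \<in> y \<odot> z" "y \<in> carrier C" "z \<in> carrier C"
  shows "z \<in> ginv C y \<odot> x"
proof -
  have x: "x \<in> carrier C" using assms by (rule mem_comp_closed)
  have "x \<in> src C y \<odot> x"
    using src_comp[OF x] src_mem_comp[OF assms] by simp
  \<comment> \<open>Expanding \<open>src C y\<close> as the composite of \<open>y\<close> with its
    inverse and rebracketing exhibits an element of \<open>ginv C y \<odot> x\<close>.\<close>
  then have "x \<in> comp_set C {y} (ginv C y \<odot> x)"
    using assms x by (simp add: comp_assoc ginv_closed comp_ginv) (simp add: comp_set_def)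
  then obtain v where v: "v \<in> ginv C y \<odot> x"
    by (auto simp: comp_set_def)
  then obtain u where "u \<in> ginv C y \<odot> y" "v \<in> u \<odot> z"
    using comp_assocD assms ginv_closed by blast
  \<comment> \<open>Here \<open>u\<close> is \<open>tgt C y\<close>, which equals
    \<open>src C z\<close> because \<open>y\<close> and \<open>z\<close> compose.\<close>
  then have "v \<in> src C z \<odot> z"
    using assms ginv_comp tgt_eq_src by fastforce
  then show ?thesis
    using v src_comp assms by simp
qed

lemma solve_left:
  assumes "x \<in> y \<odot> z" "y \<in> carrier C" "z \<in> carrier C"
  shows "y \<in> x \<odot> ginv C z"
proof -
  have x: "x \<in> carrier C" using assms by (rule mem_comp_closed)
  have "x \<in> x \<odot> tgt C z"
    using comp_tgt[OF x] tgt_mem_comp[OF assms] by simp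
  then have "x \<in> comp_set C (x \<odot> ginv C z) {z}"
    using assms x by (simp flip: comp_assoc add: ginv_closed ginv_comp) (simp add: comp_set_def)
  then obtain v where v: "v \<in> x \<odot> ginv C z"
    by (auto simp: comp_set_def)
  then obtain u where "u \<in> z \<odot> ginv C z" "v \<in> y \<odot> u"
    using comp_assocD' assms ginv_closed by blast
  then have "v \<in> y \<odot> tgt C y"
    using assms comp_ginv tgt_eq_src by fastforce
  then show ?thesis
    using v comp_tgt assms by simp
qed

text \<open>Solving \<open>tgt C x \<in> ginv C x \<odot> x\<close> for its right factor puts
  \<open>x\<close> into the composite of \<open>ginv C (ginv C x)\<close> with its own target, a
  singleton by the right unit law.\<close>

lemma ginv_ginv:
  assumes "x \<in> carrier C"
  shows "ginv C (ginv C x) = x"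
proof -
  have "tgt C x \<in> ginv C x \<odot> x"
    using assms by (simp add: ginv_comp)
  then have "x \<in> ginv C (ginv C x) \<odot> tgt C x"
    by (rule solve_right[OF _ ginv_closed[OF assms] assms])
  moreover have "tgt C x = tgt C (ginv C (ginv C x))"
    using assms by (simp add: tgt_ginv src_ginv ginv_closed)
  ultimately show ?thesis
    using assms by (simp add: comp_tgt ginv_closed)
qed

text \<open>Three solutions in a row: from \<open>x = y z\<close> to \<open>z = y\<^sup>- x\<close>,
  to \<open>y\<^sup>- = z x\<^sup>-\<close>, to \<open>x\<^sup>- = z\<^sup>- y\<^sup>-\<close>, each
  read as membership.\<close>

lemma ginv_mem_comp:
  assumes "x \<in> y \<odot> z" "y \<in> carrier C" "z \<in> carrier C"
  shows "ginv C x \<in> ginv C z \<odot> ginv C y"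
proof -
  have x: "x \<in> carrier C" using assms by (rule mem_comp_closed)
  have "z \<in> ginv C y \<odot> x"
    by (rule solve_right) fact+
  then have "ginv C y \<in> z \<odot> ginv C x"
    by (rule solve_left) (simp_all add: assms x ginv_closed)
  then show ?thesis
    by (rule solve_right) (simp_all add: assms x ginv_closed)
qed

end

section \<open>Quantales\<close>

context complete_lattice
begin

lemma sup_le_iff:
  "\<lbrakk>A \<subseteq> carrier L; a \<in> carrier L\<rbrakk> \<Longrightarrow> \<Squnion>A \<sqsubseteq> a \<longleftrightarrow> (\<forall>x\<in>A. x \<sqsubseteq> a)"
  by (meson le_trans sup_closed sup_least sup_upper subsetD)

lemma eq_if_same_upper_bounds:
  assumes "u \<in> carrier L" "v \<in> carrier L" "\<And>a. a \<in> carrier L \<Longrightarrow> u \<sqsubseteq> a \<longleftrightarrow> v \<sqsubseteq> a"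
  shows "u = v"
  using assms by (meson le_antisym le_refl)

lemma sup_empty: "\<Squnion>{} = \<bottom>"
  using weak_sup_empty unfolding eq_is_equal .

end

context quantale
begin

text \<open>Preservation of suprema, rephrased for indirect order: multiplication passes inside the
  supremum and the bound is tested on each product.\<close>

lemma qmult_sup_le_iff:
  assumes "A \<subseteq> carrier Q" "b \<in> carrier Q" "a \<in> carrier Q"
  shows "(\<Squnion>A) \<cdot> b \<sqsubseteq> a \<longleftrightarrow> (\<forall>x\<in>A. x \<cdot> b \<sqsubseteq> a)"
    and "b \<cdot> (\<Squnion>A) \<sqsubseteq> a \<longleftrightarrow> (\<forall>x\<in>A. b \<cdot> x \<sqsubseteq> a)"
proof -
  have "{x \<cdot> b | x. x \<in> A} \<subseteq> carrier Q" "{b \<cdot> x | x. x \<in> A} \<subseteq> carrier Q"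
    using assms qmult_closed by blast+
  note bounds = sup_le_iff[OF this(1) assms(3)] sup_le_iff[OF this(2) assms(3)]
  show "(\<Squnion>A) \<cdot> b \<sqsubseteq> a \<longleftrightarrow> (\<forall>x\<in>A. x \<cdot> b \<sqsubseteq> a)"
    unfolding qmult_sup_left[OF assms(1,2)] bounds(1) by fast
  show "b \<cdot> (\<Squnion>A) \<sqsubseteq> a \<longleftrightarrow> (\<forall>x\<in>A. b \<cdot> x \<sqsubseteq> a)"
    unfolding qmult_sup_right[OF assms(2,1)] bounds(2) by fast
qed

text \<open>\<open>a \<sqsubseteq> b\<close> makes \<open>b\<close> the supremum of
  \<open>{a, b}\<close>, so preservation of suprema gives monotonicity, one argument at a
  time.\<close>

lemma qmult_mono:
  assumes "a \<sqsubseteq> b" "c \<sqsubseteq> d"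
    and "a \<in> carrier Q" "b \<in> carrier Q" "c \<in> carrier Q" "d \<in> carrier Q"
  shows "a \<cdot> c \<sqsubseteq> b \<cdot> d"
proof -
  have sup: "\<Squnion>{u, v} = v" if "u \<sqsubseteq> v" "u \<in> carrier Q" "v \<in> carrier Q" for u v
    using that by (intro le_antisym sup_least sup_upper) auto
  have "a \<cdot> c \<sqsubseteq> b \<cdot> c"
    using qmult_sup_le_iff(1)[of "{a, b}" c "b \<cdot> c"] sup[OF assms(1,3,4)] assms(3-6)
    by (simp add: qmult_closed)
  also have "b \<cdot> c \<sqsubseteq> b \<cdot> d"
    using qmult_sup_le_iff(2)[of "{c, d}" b "b \<cdot> d"] sup[OF assms(2,5,6)] assms(3-6)
    by (simp add: qmult_closed)
  finally show ?thesis
    using assms by (simp add: qmult_closed)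
qed

text \<open>Bottom is the supremum of the empty set, for which the condition on products is vacuous.
  This disposes of the terms where \<open>conv_id0\<close> takes the value bottom.\<close>

lemma qmult_bottom_le:
  assumes "a \<in> carrier Q" "b \<in> carrier Q"
  shows "\<bottom> \<cdot> b \<sqsubseteq> a" and "b \<cdot> \<bottom> \<sqsubseteq> a"
  using assms qmult_sup_le_iff[of "{}" b a] by (simp_all add: sup_empty)

end

context inv_quantale
begin

lemma qstar_mono:
  assumes "a \<sqsubseteq> b" "a \<in> carrier Q" "b \<in> carrier Q"
  shows "qstar Q a \<sqsubseteq> qstar Q b"
proof -
  have "\<Squnion>{a, b} = b"
    using assms by (intro le_antisym sup_least sup_upper) auto
  then have "qstar Q b = \<Squnion>{qstar Q x | x. x \<in> {a, b}}"
    using assms qstar_sup[of "{a, b}"] by simp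
  also have "qstar Q a \<sqsubseteq> \<dots>"
    using assms by (intro sup_upper) (auto simp: qstar_closed)
  finally show ?thesis .
qed

text \<open>Apply the involution to both sides and cancel it by \<open>qstar_qstar\<close>. Moving
  the involution onto the bound makes it compatible with indirect order.\<close>

lemma qstar_le_iff:
  "\<lbrakk>a \<in> carrier Q; b \<in> carrier Q\<rbrakk> \<Longrightarrow> qstar Q a \<sqsubseteq> b \<longleftrightarrow> a \<sqsubseteq> qstar Q b"
  using qstar_mono[of "qstar Q a" b] qstar_mono[of a "qstar Q b"]
  by (auto simp: qstar_closed qstar_qstar)

end

section \<open>The convolution algebra\<close>

locale catoid_convolution = C: catoid C + Q: quantale Q
  for C :: "('c, 'm) catoid_scheme" and Q :: "('q, 'n) quantale_scheme"
begin

lemma value_closed: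
  "\<lbrakk>f \<in> carrier C \<rightarrow>\<^sub>E carrier Q; x \<in> carrier C\<rbrakk> \<Longrightarrow> f x \<in> carrier Q"
  by (rule PiE_mem)

lemma conv_eq_sup:
  "x \<in> carrier C \<Longrightarrow> conv C Q f g x =
    \<Squnion>\<^bsub>Q\<^esub>{f y \<cdot>\<^bsub>Q\<^esub> g z | y z. y \<in> carrier C \<and> z \<in> carrier C \<and> x \<in> y \<odot>\<^bsub>C\<^esub> z}"
  unfolding conv_def by (rule restrict_apply')

text \<open>\<open>R\<close> is arbitrary because the terms are compared with a bound in several
  ways: directly, after multiplication by a fixed element, and after a meet with one.\<close>

lemma ball_conv_terms:
  "(\<forall>t\<in>{f y \<cdot>\<^bsub>Q\<^esub> g z | y z. y \<in> carrier C \<and> z \<in> carrier C \<and> x \<in> y \<odot>\<^bsub>C\<^esub> z}. R t) \<longleftrightarrow>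
    (\<forall>y\<in>carrier C. \<forall>z\<in>carrier C. x \<in> y \<odot>\<^bsub>C\<^esub> z \<longrightarrow> R (f y \<cdot>\<^bsub>Q\<^esub> g z))"
  by auto

lemma conv_terms_closed:
  assumes "f \<in> carrier C \<rightarrow>\<^sub>E carrier Q" "g \<in> carrier C \<rightarrow>\<^sub>E carrier Q"
  shows "{f y \<cdot>\<^bsub>Q\<^esub> g z | y z. y \<in> carrier C \<and> z \<in> carrier C \<and> x \<in> y \<odot>\<^bsub>C\<^esub> z} \<subseteq> carrier Q"
  using assms by (blast intro: Q.qmult_closed value_closed)

lemma conv_closed:
  assumes "f \<in> carrier C \<rightarrow>\<^sub>E carrier Q" "g \<in> carrier C \<rightarrow>\<^sub>E carrier Q"
  shows "conv C Q f g \<in> carrier C \<rightarrow>\<^sub>E carrier Q"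
  unfolding conv_def restrict_PiE_iff by (intro ballI Q.sup_closed conv_terms_closed assms)

lemma conv_id0_closed: "conv_id0 C Q \<in> carrier C \<rightarrow>\<^sub>E carrier Q"
  unfolding conv_id0_def restrict_PiE_iff by (simp add: Q.qunit_closed)

lemma conv_le_iff:
  assumes "f \<in> carrier C \<rightarrow>\<^sub>E carrier Q" "g \<in> carrier C \<rightarrow>\<^sub>E carrier Q"
    and "x \<in> carrier C" "a \<in> carrier Q"
  shows "conv C Q f g x \<sqsubseteq>\<^bsub>Q\<^esub> a \<longleftrightarrow>
    (\<forall>y\<in>carrier C. \<forall>z\<in>carrier C. x \<in> y \<odot>\<^bsub>C\<^esub> z \<longrightarrow> f y \<cdot>\<^bsub>Q\<^esub> g z \<sqsubseteq>\<^bsub>Q\<^esub> a)"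
  unfolding conv_eq_sup[OF assms(3)] Q.sup_le_iff[OF conv_terms_closed[OF assms(1,2)] assms(4)]
  by (rule ball_conv_terms)

lemma conv_upper:
  assumes "f \<in> carrier C \<rightarrow>\<^sub>E carrier Q" "g \<in> carrier C \<rightarrow>\<^sub>E carrier Q"
    and "y \<in> carrier C" "z \<in> carrier C" "x \<in> y \<odot>\<^bsub>C\<^esub> z"
  shows "f y \<cdot>\<^bsub>Q\<^esub> g z \<sqsubseteq>\<^bsub>Q\<^esub> conv C Q f g x"
proof -
  have x: "x \<in> carrier C"
    using assms C.mem_comp_closed by blast
  then have "conv C Q f g x \<in> carrier Q"
    by (rule value_closed[OF conv_closed[OF assms(1,2)]])
  with conv_le_iff[OF assms(1,2) x this] show ?thesis
    using assms by simp
qed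

text \<open>Serves nested convolutions, where the inner supremum is multiplied by a value of the
  outer factor before it is compared.\<close>

lemma conv_mult_le_iff:
  assumes "f \<in> carrier C \<rightarrow>\<^sub>E carrier Q" "g \<in> carrier C \<rightarrow>\<^sub>E carrier Q"
    and "x \<in> carrier C" "a \<in> carrier Q" "b \<in> carrier Q"
  shows "conv C Q f g x \<cdot>\<^bsub>Q\<^esub> b \<sqsubseteq>\<^bsub>Q\<^esub> a \<longleftrightarrow>
      (\<forall>y\<in>carrier C. \<forall>z\<in>carrier C. x \<in> y \<odot>\<^bsub>C\<^esub> z \<longrightarrow> (f y \<cdot>\<^bsub>Q\<^esub> g z) \<cdot>\<^bsub>Q\<^esub> b \<sqsubseteq>\<^bsub>Q\<^esub> a)"
    and "b \<cdot>\<^bsub>Q\<^esub> conv C Q f g x \<sqsubseteq>\<^bsub>Q\<^esub> a \<longleftrightarrow>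
      (\<forall>y\<in>carrier C. \<forall>z\<in>carrier C. x \<in> y \<odot>\<^bsub>C\<^esub> z \<longrightarrow> b \<cdot>\<^bsub>Q\<^esub> (f y \<cdot>\<^bsub>Q\<^esub> g z) \<sqsubseteq>\<^bsub>Q\<^esub> a)"
  unfolding conv_eq_sup[OF assms(3)]
    Q.qmult_sup_le_iff[OF conv_terms_closed[OF assms(1,2)] assms(5,4)]
  by (rule ball_conv_terms)+

text \<open>An upper bound of either side is an upper bound of all threefold products over the
  splittings of \<open>x\<close>; \<open>all_triple_factorizations_assoc\<close> matches the
  splittings and \<open>qmult_assoc\<close> the products.\<close>

lemma conv_assoc:
  assumes f: "f \<in> carrier C \<rightarrow>\<^sub>E carrier Q" and g: "g \<in> carrier C \<rightarrow>\<^sub>E carrier Q"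
    and h: "h \<in> carrier C \<rightarrow>\<^sub>E carrier Q"
  shows "conv C Q (conv C Q f g) h = conv C Q f (conv C Q g h)"
proof (rule PiE_ext)
  show "conv C Q (conv C Q f g) h \<in> carrier C \<rightarrow>\<^sub>E carrier Q"
    "conv C Q f (conv C Q g h) \<in> carrier C \<rightarrow>\<^sub>E carrier Q"
    using assms by (simp_all add: conv_closed)
  note closed = value_closed[OF this(1)] value_closed[OF this(2)]
  note mem = value_closed[OF f] value_closed[OF g] value_closed[OF h]
  fix x assume x: "x \<in> carrier C"
  show "conv C Q (conv C Q f g) h x = conv C Q f (conv C Q g h) x"
  proof (rule Q.eq_if_same_upper_bounds)
    fix a assume a: "a \<in> carrier Q"
    have "conv C Q (conv C Q f g) h x \<sqsubseteq>\<^bsub>Q\<^esub> a \<longleftrightarrow>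
      (\<forall>y\<in>carrier C. \<forall>z\<in>carrier C. x \<in> y \<odot>\<^bsub>C\<^esub> z \<longrightarrow>
        (\<forall>u\<in>carrier C. \<forall>v\<in>carrier C. y \<in> u \<odot>\<^bsub>C\<^esub> v \<longrightarrow> (f u \<cdot>\<^bsub>Q\<^esub> g v) \<cdot>\<^bsub>Q\<^esub> h z \<sqsubseteq>\<^bsub>Q\<^esub> a))"
      unfolding conv_le_iff[OF conv_closed[OF f g] h x a]
      using conv_mult_le_iff(1)[OF f g _ a mem(3)] by simp
    also have "\<dots> \<longleftrightarrow>
      (\<forall>u\<in>carrier C. \<forall>w\<in>carrier C. x \<in> u \<odot>\<^bsub>C\<^esub> w \<longrightarrow>
        (\<forall>v\<in>carrier C. \<forall>z\<in>carrier C. w \<in> v \<odot>\<^bsub>C\<^esub> z \<longrightarrow> (f u \<cdot>\<^bsub>Q\<^esub> g v) \<cdot>\<^bsub>Q\<^esub> h z \<sqsubseteq>\<^bsub>Q\<^esub> a))"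
      by (rule C.all_triple_factorizations_assoc[where
            P = "\<lambda>u v z. (f u \<cdot>\<^bsub>Q\<^esub> g v) \<cdot>\<^bsub>Q\<^esub> h z \<sqsubseteq>\<^bsub>Q\<^esub> a"])
    also have "\<dots> \<longleftrightarrow> conv C Q f (conv C Q g h) x \<sqsubseteq>\<^bsub>Q\<^esub> a"
      unfolding conv_le_iff[OF f conv_closed[OF g h] x a]
      using conv_mult_le_iff(2)[OF g h _ a mem(1)] by (simp add: mem Q.qmult_assoc)
    finally show "conv C Q (conv C Q f g) h x \<sqsubseteq>\<^bsub>Q\<^esub> a \<longleftrightarrow>
      conv C Q f (conv C Q g h) x \<sqsubseteq>\<^bsub>Q\<^esub> a" .
  qed (rule closed[OF x])+
qed

text \<open>A factorization of \<open>x\<close> whose left factor is an identity has right factor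
  \<open>x\<close> and contributes \<open>f x\<close>; in every other one the left value is
  bottom.\<close>

lemma conv_id0_left:
  assumes f: "f \<in> carrier C \<rightarrow>\<^sub>E carrier Q"
  shows "conv C Q (conv_id0 C Q) f = f"
proof (rule PiE_ext[OF conv_closed[OF conv_id0_closed f] f])
  fix x assume x: "x \<in> carrier C"
  show "conv C Q (conv_id0 C Q) f x = f x"
  proof (rule Q.le_antisym)
    show "conv C Q (conv_id0 C Q) f x \<sqsubseteq>\<^bsub>Q\<^esub> f x"
      unfolding conv_le_iff[OF conv_id0_closed f x value_closed[OF f x]]
    proof (intro ballI impI)
      fix y z assume yz: "y \<in> carrier C" "z \<in> carrier C" and mem: "x \<in> y \<odot>\<^bsub>C\<^esub> z"
      have "x = z" if "src C y = y"
      proof -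
        have "y = src C z"
          using C.tgt_eq_src[OF mem yz] C.tgt_src[OF yz(1)] that by simp
        then show ?thesis
          using mem yz C.src_comp by simp
      qed
      then show "conv_id0 C Q y \<cdot>\<^bsub>Q\<^esub> f z \<sqsubseteq>\<^bsub>Q\<^esub> f x"
        using f x yz by (auto simp: conv_id0_def Q.qunit_left Q.qmult_bottom_le value_closed[OF f])
    qed
    \<comment> \<open>The bound is attained at the factorization of \<open>x\<close> into
      \<open>src C x\<close> and \<open>x\<close>.\<close>
    show "f x \<sqsubseteq>\<^bsub>Q\<^esub> conv C Q (conv_id0 C Q) f x"
      using conv_upper[OF conv_id0_closed f, of "src C x" x x] f x
      by (simp add: C.src_closed C.src_comp C.src_src conv_id0_def Q.qunit_left value_closed[OF f])
  qed (rule value_closed[OF conv_closed[OF conv_id0_closed f] x] value_closed[OF f x])+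
qed

text \<open>Since \<open>conv_id0\<close> tests \<open>src\<close>, a right factor \<open>z\<close>
  with \<open>src C z = z\<close> is \<open>tgt C y\<close>, whence \<open>x = y\<close>. The bound
  is attained at \<open>tgt C x\<close>, which passes the test by \<open>src_tgt\<close>.\<close>

lemma conv_id0_right:
  assumes f: "f \<in> carrier C \<rightarrow>\<^sub>E carrier Q"
  shows "conv C Q f (conv_id0 C Q) = f"
proof (rule PiE_ext[OF conv_closed[OF f conv_id0_closed] f])
  fix x assume x: "x \<in> carrier C"
  show "conv C Q f (conv_id0 C Q) x = f x"
  proof (rule Q.le_antisym)
    show "conv C Q f (conv_id0 C Q) x \<sqsubseteq>\<^bsub>Q\<^esub> f x"
      unfolding conv_le_iff[OF f conv_id0_closed x value_closed[OF f x]]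
    proof (intro ballI impI)
      fix y z assume yz: "y \<in> carrier C" "z \<in> carrier C" and mem: "x \<in> y \<odot>\<^bsub>C\<^esub> z"
      have "x = y" if "src C z = z"
        using C.tgt_eq_src[OF mem yz] C.comp_tgt[OF yz(1)] that mem by simp
      then show "f y \<cdot>\<^bsub>Q\<^esub> conv_id0 C Q z \<sqsubseteq>\<^bsub>Q\<^esub> f x"
        using f x yz by (auto simp: conv_id0_def Q.qunit_right Q.qmult_bottom_le value_closed[OF f])
    qed
    show "f x \<sqsubseteq>\<^bsub>Q\<^esub> conv C Q f (conv_id0 C Q) x"
      using conv_upper[OF f conv_id0_closed, of x "tgt C x" x] f x
      by (simp add: C.tgt_closed C.comp_tgt C.src_tgt conv_id0_def Q.qunit_right value_closed[OF f])
  qed (rule value_closed[OF conv_closed[OF f conv_id0_closed] x] value_closed[OF f x])+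
qed

lemma values_closed:
  "\<lbrakk>F \<subseteq> carrier C \<rightarrow>\<^sub>E carrier Q; x \<in> carrier C\<rbrakk> \<Longrightarrow> {f x | f. f \<in> F} \<subseteq> carrier Q"
  by (blast intro: value_closed)

lemma ball_values: "(\<forall>t\<in>{f x | f. f \<in> F}. R t) \<longleftrightarrow> (\<forall>f\<in>F. R (f x))"
  by auto

lemma pointwise_sup_closed:
  "F \<subseteq> carrier C \<rightarrow>\<^sub>E carrier Q \<Longrightarrow>
    (\<lambda>x\<in>carrier C. \<Squnion>\<^bsub>Q\<^esub>{f x | f. f \<in> F}) \<in> carrier C \<rightarrow>\<^sub>E carrier Q"
  unfolding restrict_PiE_iff by (intro ballI Q.sup_closed values_closed)

text \<open>Stated with explicit pointwise suprema, since the lattice structure on the maps is set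
  up only later. Against an upper bound, both sides become universal conditions on the members of
  \<open>G\<close> and the factorizations of \<open>x\<close>.\<close>

lemma conv_sup_right:
  assumes f: "f \<in> carrier C \<rightarrow>\<^sub>E carrier Q" and G: "G \<subseteq> carrier C \<rightarrow>\<^sub>E carrier Q"
  shows "conv C Q f (\<lambda>x\<in>carrier C. \<Squnion>\<^bsub>Q\<^esub>{g x | g. g \<in> G}) =
    (\<lambda>x\<in>carrier C. \<Squnion>\<^bsub>Q\<^esub>{h x | h. h \<in> {conv C Q f g | g. g \<in> G}})" (is "?l = ?r")
proof (rule PiE_ext)
  have G': "{conv C Q f g | g. g \<in> G} \<subseteq> carrier C \<rightarrow>\<^sub>E carrier Q"
    using G conv_closed[OF f] by blast
  show closed: "?l \<in> carrier C \<rightarrow>\<^sub>E carrier Q" "?r \<in> carrier C \<rightarrow>\<^sub>E carrier Q"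
    by (intro conv_closed pointwise_sup_closed f G G')+
  fix x assume x: "x \<in> carrier C"
  show "?l x = ?r x"
  proof (rule Q.eq_if_same_upper_bounds)
    fix a assume a: "a \<in> carrier Q"
    have "?l x \<sqsubseteq>\<^bsub>Q\<^esub> a \<longleftrightarrow> (\<forall>y\<in>carrier C. \<forall>z\<in>carrier C. x \<in> y \<odot>\<^bsub>C\<^esub> z \<longrightarrow>
        f y \<cdot>\<^bsub>Q\<^esub> (\<Squnion>\<^bsub>Q\<^esub>{g z | g. g \<in> G}) \<sqsubseteq>\<^bsub>Q\<^esub> a)"
      unfolding conv_le_iff[OF f pointwise_sup_closed[OF G] x a] by simp
    also have "\<dots> \<longleftrightarrow> (\<forall>y\<in>carrier C. \<forall>z\<in>carrier C. x \<in> y \<odot>\<^bsub>C\<^esub> z \<longrightarrow>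
        (\<forall>g\<in>G. f y \<cdot>\<^bsub>Q\<^esub> g z \<sqsubseteq>\<^bsub>Q\<^esub> a))"
    proof (intro ball_cong refl imp_cong)
      fix y z assume "y \<in> carrier C" "z \<in> carrier C"
      then show "f y \<cdot>\<^bsub>Q\<^esub> (\<Squnion>\<^bsub>Q\<^esub>{g z | g. g \<in> G}) \<sqsubseteq>\<^bsub>Q\<^esub> a \<longleftrightarrow>
          (\<forall>g\<in>G. f y \<cdot>\<^bsub>Q\<^esub> g z \<sqsubseteq>\<^bsub>Q\<^esub> a)"
        using Q.qmult_sup_le_iff(2)[OF values_closed[OF G] value_closed[OF f] a]
        by (simp only: ball_values)
    qed
    also have "\<dots> \<longleftrightarrow> (\<forall>g\<in>G. \<forall>y\<in>carrier C. \<forall>z\<in>carrier C. x \<in> y \<odot>\<^bsub>C\<^esub> z \<longrightarrow>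
        f y \<cdot>\<^bsub>Q\<^esub> g z \<sqsubseteq>\<^bsub>Q\<^esub> a)"
      \<comment> \<open>Interchanging the quantifiers moves the supremum over \<open>G\<close>
        outside the convolution.\<close>
      by meson
    also have "\<dots> \<longleftrightarrow> (\<forall>g\<in>G. conv C Q f g x \<sqsubseteq>\<^bsub>Q\<^esub> a)"
      by (intro ball_cong refl conv_le_iff[OF f _ x a, symmetric]) (rule subsetD[OF G])
    also have "\<dots> \<longleftrightarrow> (\<forall>h\<in>{conv C Q f g | g. g \<in> G}. h x \<sqsubseteq>\<^bsub>Q\<^esub> a)"
      by (simp only: Setcompr_eq_image ball_simps)
    also have "\<dots> \<longleftrightarrow> ?r x \<sqsubseteq>\<^bsub>Q\<^esub> a"
      unfolding restrict_apply'[OF x] Q.sup_le_iff[OF values_closed[OF G' x] a] ball_values ..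
    finally show "?l x \<sqsubseteq>\<^bsub>Q\<^esub> a \<longleftrightarrow> ?r x \<sqsubseteq>\<^bsub>Q\<^esub> a" .
  qed (rule value_closed[OF closed(1) x] value_closed[OF closed(2) x])+
qed

lemma conv_sup_left:
  assumes G: "G \<subseteq> carrier C \<rightarrow>\<^sub>E carrier Q" and f: "f \<in> carrier C \<rightarrow>\<^sub>E carrier Q"
  shows "conv C Q (\<lambda>x\<in>carrier C. \<Squnion>\<^bsub>Q\<^esub>{g x | g. g \<in> G}) f =
    (\<lambda>x\<in>carrier C. \<Squnion>\<^bsub>Q\<^esub>{h x | h. h \<in> {conv C Q g f | g. g \<in> G}})" (is "?l = ?r")
proof (rule PiE_ext)
  have G': "{conv C Q g f | g. g \<in> G} \<subseteq> carrier C \<rightarrow>\<^sub>E carrier Q"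
    using G conv_closed[OF _ f] by blast
  show closed: "?l \<in> carrier C \<rightarrow>\<^sub>E carrier Q" "?r \<in> carrier C \<rightarrow>\<^sub>E carrier Q"
    by (intro conv_closed pointwise_sup_closed f G G')+
  fix x assume x: "x \<in> carrier C"
  show "?l x = ?r x"
  proof (rule Q.eq_if_same_upper_bounds)
    fix a assume a: "a \<in> carrier Q"
    have "?l x \<sqsubseteq>\<^bsub>Q\<^esub> a \<longleftrightarrow> (\<forall>y\<in>carrier C. \<forall>z\<in>carrier C. x \<in> y \<odot>\<^bsub>C\<^esub> z \<longrightarrow>
        (\<Squnion>\<^bsub>Q\<^esub>{g y | g. g \<in> G}) \<cdot>\<^bsub>Q\<^esub> f z \<sqsubseteq>\<^bsub>Q\<^esub> a)"
      unfolding conv_le_iff[OF pointwise_sup_closed[OF G] f x a] by simp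
    also have "\<dots> \<longleftrightarrow> (\<forall>y\<in>carrier C. \<forall>z\<in>carrier C. x \<in> y \<odot>\<^bsub>C\<^esub> z \<longrightarrow>
        (\<forall>g\<in>G. g y \<cdot>\<^bsub>Q\<^esub> f z \<sqsubseteq>\<^bsub>Q\<^esub> a))"
    proof (intro ball_cong refl imp_cong)
      fix y z assume "y \<in> carrier C" "z \<in> carrier C"
      then show "(\<Squnion>\<^bsub>Q\<^esub>{g y | g. g \<in> G}) \<cdot>\<^bsub>Q\<^esub> f z \<sqsubseteq>\<^bsub>Q\<^esub> a \<longleftrightarrow>
          (\<forall>g\<in>G. g y \<cdot>\<^bsub>Q\<^esub> f z \<sqsubseteq>\<^bsub>Q\<^esub> a)"
        using Q.qmult_sup_le_iff(1)[OF values_closed[OF G] value_closed[OF f] a]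
        by (simp only: ball_values)
    qed
    also have "\<dots> \<longleftrightarrow> (\<forall>g\<in>G. \<forall>y\<in>carrier C. \<forall>z\<in>carrier C. x \<in> y \<odot>\<^bsub>C\<^esub> z \<longrightarrow>
        g y \<cdot>\<^bsub>Q\<^esub> f z \<sqsubseteq>\<^bsub>Q\<^esub> a)"
      by meson
    also have "\<dots> \<longleftrightarrow> (\<forall>g\<in>G. conv C Q g f x \<sqsubseteq>\<^bsub>Q\<^esub> a)"
      by (intro ball_cong refl conv_le_iff[OF _ f x a, symmetric]) (rule subsetD[OF G])
    also have "\<dots> \<longleftrightarrow> (\<forall>h\<in>{conv C Q g f | g. g \<in> G}. h x \<sqsubseteq>\<^bsub>Q\<^esub> a)"
      by (simp only: Setcompr_eq_image ball_simps)
    also have "\<dots> \<longleftrightarrow> ?r x \<sqsubseteq>\<^bsub>Q\<^esub> a"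
      unfolding restrict_apply'[OF x] Q.sup_le_iff[OF values_closed[OF G' x] a] ball_values ..
    finally show "?l x \<sqsubseteq>\<^bsub>Q\<^esub> a \<longleftrightarrow> ?r x \<sqsubseteq>\<^bsub>Q\<^esub> a" .
  qed (rule value_closed[OF closed(1) x] value_closed[OF closed(2) x])+
qed

end

section \<open>The pointwise complete lattice and the quantale of maps\<close>

locale groupoid_convolution = C: groupoid C + Q: inv_quantale Q
  for C :: "('c, 'm) groupoid_scheme" and Q :: "('q, 'n) inv_quantale_scheme"
begin

sublocale catoid_convolution C Q ..

lemma carrier_conv_quantale: "carrier (conv_quantale C Q) = (carrier C \<rightarrow>\<^sub>E carrier Q)"
  and le_conv_quantale: "f \<sqsubseteq>\<^bsub>conv_quantale C Q\<^esub> g \<longleftrightarrow> (\<forall>x\<in>carrier C. f x \<sqsubseteq>\<^bsub>Q\<^esub> g x)"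
  and eq_conv_quantale: "f .=\<^bsub>conv_quantale C Q\<^esub> g \<longleftrightarrow> f = g"
  and qmult_conv_quantale: "f \<cdot>\<^bsub>conv_quantale C Q\<^esub> g = conv C Q f g"
  and qunit_conv_quantale: "qunit (conv_quantale C Q) = conv_id0 C Q"
  and qstar_conv_quantale: "qstar (conv_quantale C Q) f = conv_star C Q f"
  by (simp_all add: conv_quantale_def)

lemmas conv_quantale_simps = carrier_conv_quantale le_conv_quantale eq_conv_quantale
  qmult_conv_quantale qunit_conv_quantale qstar_conv_quantale

lemma conv_partial_order: "partial_order (conv_quantale C Q)"
proof
  fix f g h
  assume "f \<sqsubseteq>\<^bsub>conv_quantale C Q\<^esub> g" "g \<sqsubseteq>\<^bsub>conv_quantale C Q\<^esub> h"
    and "f \<in> carrier (conv_quantale C Q)" "g \<in> carrier (conv_quantale C Q)"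
      "h \<in> carrier (conv_quantale C Q)"
  then show "f \<sqsubseteq>\<^bsub>conv_quantale C Q\<^esub> h"
    unfolding conv_quantale_simps by (blast intro: Q.le_trans value_closed)
next
  fix f g
  assume "f \<sqsubseteq>\<^bsub>conv_quantale C Q\<^esub> g" "g \<sqsubseteq>\<^bsub>conv_quantale C Q\<^esub> f"
    and "f \<in> carrier (conv_quantale C Q)" "g \<in> carrier (conv_quantale C Q)"
  then show "f .=\<^bsub>conv_quantale C Q\<^esub> g"
    \<comment> \<open>The maps are extensional, so agreement on \<open>carrier C\<close> is
      equality.\<close>
    unfolding conv_quantale_simps by (blast intro: Q.le_antisym value_closed PiE_ext)
qed (auto simp: conv_quantale_simps fun_eq_iff)

text \<open>Phrased with \<open>least\<close> and \<open>Upper\<close> so that it can both prove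
  completeness and, by uniqueness of least upper bounds, identify \<open>\<Squnion>\<close>
  afterwards in \<open>sup_conv_quantale\<close>.\<close>

lemma pointwise_sup_least:
  assumes F: "F \<subseteq> carrier C \<rightarrow>\<^sub>E carrier Q"
  shows "least (conv_quantale C Q) (\<lambda>x\<in>carrier C. \<Squnion>\<^bsub>Q\<^esub>{f x | f. f \<in> F})
    (Upper (conv_quantale C Q) F)"
proof -
  have "{f x | f. f \<in> F} \<subseteq> carrier Q" if "x \<in> carrier C" for x
    using F that by auto
  then show ?thesis
    using F pointwise_sup_closed[OF F]
    by (auto simp: least_def Upper_def conv_quantale_simps subset_iff
        intro: value_closed intro!: Q.sup_upper Q.sup_least)
qed

lemma pointwise_inf_greatest:
  assumes F: "F \<subseteq> carrier C \<rightarrow>\<^sub>E carrier Q"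
  shows "greatest (conv_quantale C Q) (\<lambda>x\<in>carrier C. \<Sqinter>\<^bsub>Q\<^esub>{f x | f. f \<in> F})
    (Lower (conv_quantale C Q) F)"
proof -
  have sub: "{f x | f. f \<in> F} \<subseteq> carrier Q" if "x \<in> carrier C" for x
    using F that by auto
  then have "(\<lambda>x\<in>carrier C. \<Sqinter>\<^bsub>Q\<^esub>{f x | f. f \<in> F}) \<in> carrier C \<rightarrow>\<^sub>E carrier Q"
    by (auto intro!: Q.inf_closed)
  then show ?thesis
    using F sub
    by (auto simp: greatest_def Lower_def conv_quantale_simps subset_iff
        intro: value_closed intro!: Q.inf_lower Q.inf_greatest)
qed

lemma conv_complete_lattice: "complete_lattice (conv_quantale C Q)"
proof -
  interpret D: partial_order "conv_quantale C Q" by (rule conv_partial_order)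
  show ?thesis
    by (rule D.complete_latticeI; intro exI)
      (rule pointwise_sup_least pointwise_inf_greatest, simp add: conv_quantale_simps)+
qed

lemma sup_conv_quantale:
  assumes F: "F \<subseteq> carrier C \<rightarrow>\<^sub>E carrier Q"
  shows "\<Squnion>\<^bsub>conv_quantale C Q\<^esub>F = (\<lambda>x\<in>carrier C. \<Squnion>\<^bsub>Q\<^esub>{f x | f. f \<in> F})"
proof -
  interpret D: complete_lattice "conv_quantale C Q" by (rule conv_complete_lattice)
  show ?thesis
    by (rule D.least_unique[OF D.sup_lub pointwise_sup_least[OF F]])
      (simp add: conv_quantale_simps F)
qed

lemma inf_conv_quantale:
  assumes F: "F \<subseteq> carrier C \<rightarrow>\<^sub>E carrier Q"
  shows "\<Sqinter>\<^bsub>conv_quantale C Q\<^esub>F = (\<lambda>x\<in>carrier C. \<Sqinter>\<^bsub>Q\<^esub>{f x | f. f \<in> F})"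
proof -
  interpret D: complete_lattice "conv_quantale C Q" by (rule conv_complete_lattice)
  show ?thesis
    by (rule D.greatest_unique[OF D.inf_glb pointwise_inf_greatest[OF F]])
      (simp add: conv_quantale_simps F)
qed

lemma meet_conv_quantale:
  assumes "f \<in> carrier C \<rightarrow>\<^sub>E carrier Q" "g \<in> carrier C \<rightarrow>\<^sub>E carrier Q"
  shows "f \<sqinter>\<^bsub>conv_quantale C Q\<^esub> g = (\<lambda>x\<in>carrier C. f x \<sqinter>\<^bsub>Q\<^esub> g x)"
proof -
  have "{h x | h. h \<in> {f, g}} = {f x, g x}" for x
    by auto
  then show ?thesis
    using assms by (simp add: meet_def inf_conv_quantale)
qed

lemma conv_quantale: "quantale (conv_quantale C Q)"
proof -
  interpret D: complete_lattice "conv_quantale C Q" by (rule conv_complete_lattice)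
  show ?thesis
  proof
    fix f G assume "f \<in> carrier (conv_quantale C Q)" "G \<subseteq> carrier (conv_quantale C Q)"
    then have fG: "f \<in> carrier C \<rightarrow>\<^sub>E carrier Q" "G \<subseteq> carrier C \<rightarrow>\<^sub>E carrier Q"
      by (simp_all add: conv_quantale_simps)
    \<comment> \<open>\<open>sup_conv_quantale\<close> can rewrite the right-hand suprema only if
      these families lie in the carrier.\<close>
    have "{conv C Q f g | g. g \<in> G} \<subseteq> carrier C \<rightarrow>\<^sub>E carrier Q"
      using fG(2) conv_closed[OF fG(1)] by blast
    moreover have "{conv C Q g f | g. g \<in> G} \<subseteq> carrier C \<rightarrow>\<^sub>E carrier Q"
      using fG(2) conv_closed[OF _ fG(1)] by blast
    ultimately show "f \<cdot>\<^bsub>conv_quantale C Q\<^esub> (\<Squnion>\<^bsub>conv_quantale C Q\<^esub>G) =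
        \<Squnion>\<^bsub>conv_quantale C Q\<^esub>{f \<cdot>\<^bsub>conv_quantale C Q\<^esub> g | g. g \<in> G}"
      "(\<Squnion>\<^bsub>conv_quantale C Q\<^esub>G) \<cdot>\<^bsub>conv_quantale C Q\<^esub> f =
        \<Squnion>\<^bsub>conv_quantale C Q\<^esub>{g \<cdot>\<^bsub>conv_quantale C Q\<^esub> f | g. g \<in> G}"
      by (simp_all only: conv_quantale_simps sup_conv_quantale fG conv_sup_left conv_sup_right)
  qed (simp_all add: conv_quantale_simps conv_closed conv_id0_closed conv_assoc
      conv_id0_left conv_id0_right)
qed

section \<open>The involution on maps\<close>

lemma conv_star_apply: "x \<in> carrier C \<Longrightarrow> conv_star C Q f x = qstar Q (f (ginv C x))"
  by (simp add: conv_star_def)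

lemma conv_star_closed:
  "f \<in> carrier C \<rightarrow>\<^sub>E carrier Q \<Longrightarrow> conv_star C Q f \<in> carrier C \<rightarrow>\<^sub>E carrier Q"
  by (auto simp: conv_star_def intro!: Q.qstar_closed C.ginv_closed)

lemma conv_star_conv_star:
  assumes f: "f \<in> carrier C \<rightarrow>\<^sub>E carrier Q"
  shows "conv_star C Q (conv_star C Q f) = f"
  by (rule PiE_ext[OF conv_star_closed[OF conv_star_closed[OF f]] f])
    (use f in \<open>simp add: conv_star_apply C.ginv_closed C.ginv_ginv Q.qstar_qstar value_closed[OF f]\<close>)

lemma conv_star_sup:
  assumes F: "F \<subseteq> carrier C \<rightarrow>\<^sub>E carrier Q"
  shows "conv_star C Q (\<lambda>x\<in>carrier C. \<Squnion>\<^bsub>Q\<^esub>{f x | f. f \<in> F}) =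
    (\<lambda>x\<in>carrier C. \<Squnion>\<^bsub>Q\<^esub>{h x | h. h \<in> {conv_star C Q f | f. f \<in> F}})"
\<comment> \<open>Only the outer \<open>conv_star\<close>, the one applied to a restriction, is
  unfolded; those inside the family on the right stay folded.\<close>
proof (unfold conv_star_def[of C Q "restrict _ _"], rule restrict_ext)
  fix x assume x: "x \<in> carrier C"
  have sub: "{f (ginv C x) | f. f \<in> F} \<subseteq> carrier Q"
    using F x C.ginv_closed by auto
  have "{qstar Q a | a. a \<in> {f (ginv C x) | f. f \<in> F}} =
      {h x | h. h \<in> {conv_star C Q f | f. f \<in> F}}"
    using x by (auto simp: conv_star_apply) (metis conv_star_apply)
  then show "qstar Q ((\<lambda>x\<in>carrier C. \<Squnion>\<^bsub>Q\<^esub>{f x | f. f \<in> F}) (ginv C x)) =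
      \<Squnion>\<^bsub>Q\<^esub>{h x | h. h \<in> {conv_star C Q f | f. f \<in> F}}"
    using x Q.qstar_sup[OF sub] by (simp add: C.ginv_closed)
qed

text \<open>Inversion reverses factorizations and \<open>qstar\<close> reverses products, so the
  terms on the two sides correspond. The involution is moved onto the bound first, which leaves a
  plain convolution at \<open>ginv C x\<close>.\<close>

lemma conv_star_conv:
  assumes f: "f \<in> carrier C \<rightarrow>\<^sub>E carrier Q" and g: "g \<in> carrier C \<rightarrow>\<^sub>E carrier Q"
  shows "conv_star C Q (conv C Q f g) = conv C Q (conv_star C Q g) (conv_star C Q f)"
    (is "?l = ?r")
proof (rule PiE_ext)
  show closed: "?l \<in> carrier C \<rightarrow>\<^sub>E carrier Q" "?r \<in> carrier C \<rightarrow>\<^sub>E carrier Q"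
    by (intro conv_closed conv_star_closed f g)+
  fix x assume x: "x \<in> carrier C"
  show "?l x = ?r x"
  proof (rule Q.eq_if_same_upper_bounds)
    fix a assume a: "a \<in> carrier Q"
    have mem: "conv C Q f g (ginv C x) \<in> carrier Q"
      using conv_closed[OF f g] C.ginv_closed[OF x] by (rule value_closed)
    have "?l x \<sqsubseteq>\<^bsub>Q\<^esub> a \<longleftrightarrow> conv C Q f g (ginv C x) \<sqsubseteq>\<^bsub>Q\<^esub> qstar Q a"
      using x a mem by (simp add: conv_star_apply Q.qstar_le_iff)
    also have "\<dots> \<longleftrightarrow> (\<forall>y\<in>carrier C. \<forall>z\<in>carrier C. ginv C x \<in> y \<odot>\<^bsub>C\<^esub> z \<longrightarrow>
        f y \<cdot>\<^bsub>Q\<^esub> g z \<sqsubseteq>\<^bsub>Q\<^esub> qstar Q a)"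
      using f g x a by (simp add: conv_le_iff C.ginv_closed Q.qstar_closed)
    \<comment> \<open>Reindexing by inverses: \<open>ginv_mem_comp\<close> turns factorizations of
      \<open>ginv C x\<close> into reversed ones of \<open>x\<close>, and \<open>ginv_ginv\<close>
      makes this a bijection.\<close>
    also have "\<dots> \<longleftrightarrow> (\<forall>z\<in>carrier C. \<forall>y\<in>carrier C. x \<in> z \<odot>\<^bsub>C\<^esub> y \<longrightarrow>
        f (ginv C y) \<cdot>\<^bsub>Q\<^esub> g (ginv C z) \<sqsubseteq>\<^bsub>Q\<^esub> qstar Q a)"
      using C.ginv_mem_comp C.ginv_closed C.ginv_ginv x by metis
    also have "\<dots> \<longleftrightarrow> ?r x \<sqsubseteq>\<^bsub>Q\<^esub> a"
      using f g x a
      by (simp add: conv_le_iff conv_star_closed conv_star_apply value_closed[OF f] value_closed[OF g] C.ginv_closed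
          Q.qmult_closed flip: Q.qstar_qmult Q.qstar_le_iff)
    finally show "?l x \<sqsubseteq>\<^bsub>Q\<^esub> a \<longleftrightarrow> ?r x \<sqsubseteq>\<^bsub>Q\<^esub> a" .
  qed (rule value_closed[OF closed(1) x] value_closed[OF closed(2) x])+
qed

lemma conv_inv_quantale: "inv_quantale (conv_quantale C Q)"
proof -
  interpret D: quantale "conv_quantale C Q" by (rule conv_quantale)
  show ?thesis
  proof
    fix F assume "F \<subseteq> carrier (conv_quantale C Q)"
    then have F: "F \<subseteq> carrier C \<rightarrow>\<^sub>E carrier Q"
      by (simp add: conv_quantale_simps)
    then have "{conv_star C Q f | f. f \<in> F} \<subseteq> carrier C \<rightarrow>\<^sub>E carrier Q"
      using conv_star_closed by blast
    with F show "qstar (conv_quantale C Q) (\<Squnion>\<^bsub>conv_quantale C Q\<^esub>F) =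
        \<Squnion>\<^bsub>conv_quantale C Q\<^esub>{qstar (conv_quantale C Q) f | f. f \<in> F}"
      by (simp only: conv_quantale_simps sup_conv_quantale conv_star_sup)
  qed (simp_all add: conv_quantale_simps conv_star_closed conv_star_conv_star conv_star_conv)
qed

text \<open>Meets and suprema of maps are computed pointwise, so the law is inherited at each
  \<open>x\<close>; what remains is to identify the families of values.\<close>

lemma conv_inf_distrib_sups:
  assumes distrib: "inf_distrib_sups Q"
  shows "inf_distrib_sups (conv_quantale C Q)"
  unfolding inf_distrib_sups_def
proof (intro ballI allI impI)
  fix f G assume "f \<in> carrier (conv_quantale C Q)" "G \<subseteq> carrier (conv_quantale C Q)"
  then have f: "f \<in> carrier C \<rightarrow>\<^sub>E carrier Q" and G: "G \<subseteq> carrier C \<rightarrow>\<^sub>E carrier Q"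
    by (simp_all add: conv_quantale_simps)
  let ?H = "{f \<sqinter>\<^bsub>conv_quantale C Q\<^esub> g | g. g \<in> G}"
  interpret D: complete_lattice "conv_quantale C Q" by (rule conv_complete_lattice)
  have H: "?H \<subseteq> carrier C \<rightarrow>\<^sub>E carrier Q"
    using G D.meet_closed[of f] f unfolding conv_quantale_simps by blast
  have "f x \<sqinter>\<^bsub>Q\<^esub> (\<Squnion>\<^bsub>Q\<^esub>{g x | g. g \<in> G}) = \<Squnion>\<^bsub>Q\<^esub>{h x | h. h \<in> ?H}" if x: "x \<in> carrier C" for x
  proof -
    have "f x \<in> carrier Q" "{g x | g. g \<in> G} \<subseteq> carrier Q"
      using f G x by auto
    then have "f x \<sqinter>\<^bsub>Q\<^esub> (\<Squnion>\<^bsub>Q\<^esub>{g x | g. g \<in> G}) =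
        \<Squnion>\<^bsub>Q\<^esub>{f x \<sqinter>\<^bsub>Q\<^esub> b | b. b \<in> {g x | g. g \<in> G}}"
      using distrib by (simp only: inf_distrib_sups_def)
    also have "{f x \<sqinter>\<^bsub>Q\<^esub> b | b. b \<in> {g x | g. g \<in> G}} = {f x \<sqinter>\<^bsub>Q\<^esub> g x | g. g \<in> G}"
      by blast
    also have "\<dots> = {(f \<sqinter>\<^bsub>conv_quantale C Q\<^esub> g) x | g. g \<in> G}"
      unfolding Setcompr_eq_image
      by (rule image_cong[OF refl]) (simp add: meet_conv_quantale[OF f subsetD[OF G]] x)
    also have "\<dots> = {h x | h. h \<in> ?H}"
      by (simp only: Setcompr_eq_image image_image)
    finally show ?thesis .
  qed
  then show "f \<sqinter>\<^bsub>conv_quantale C Q\<^esub> (\<Squnion>\<^bsub>conv_quantale C Q\<^esub>G) = \<Squnion>\<^bsub>conv_quantale C Q\<^esub>?H"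
    unfolding sup_conv_quantale[OF H] sup_conv_quantale[OF G]
    by (subst meet_conv_quantale[OF f pointwise_sup_closed[OF G]]) (rule restrict_ext, simp)
qed

end

text \<open>The two factors on the right are written as the restrictions that
  \<open>meet_conv_quantale\<close> produces, so that this is the value at \<open>x\<close> of the
  Dedekind law for maps.\<close>

lemma conv_dedekind:
  fixes C :: "('c, 'm) groupoid_scheme" and Q :: "('q, 'n) inv_quantale_scheme"
  assumes "groupoid C" "dedekind_quantale Q" and distrib: "inf_distrib_sups Q"
    and f: "f \<in> carrier C \<rightarrow>\<^sub>E carrier Q" and g: "g \<in> carrier C \<rightarrow>\<^sub>E carrier Q"
    and h: "h \<in> carrier C \<rightarrow>\<^sub>E carrier Q" and x: "x \<in> carrier C"
  shows "conv C Q f g x \<sqinter>\<^bsub>Q\<^esub> h x \<sqsubseteq>\<^bsub>Q\<^esub>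
    conv C Q (\<lambda>y\<in>carrier C. f y \<sqinter>\<^bsub>Q\<^esub> conv C Q h (conv_star C Q g) y)
      (\<lambda>z\<in>carrier C. g z \<sqinter>\<^bsub>Q\<^esub> conv C Q (conv_star C Q f) h z) x"
    (is "_ \<sqsubseteq>\<^bsub>Q\<^esub> conv C Q ?f ?g x")
proof -
  interpret C: groupoid C by fact
  interpret Q: dedekind_quantale Q by fact
  interpret groupoid_convolution C Q ..
  let ?T = "{f y \<cdot>\<^bsub>Q\<^esub> g z | y z. y \<in> carrier C \<and> z \<in> carrier C \<and> x \<in> y \<odot>\<^bsub>C\<^esub> z}"
  have hg: "conv C Q h (conv_star C Q g) \<in> carrier C \<rightarrow>\<^sub>E carrier Q"
    and fh: "conv C Q (conv_star C Q f) h \<in> carrier C \<rightarrow>\<^sub>E carrier Q"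
    by (intro conv_closed conv_star_closed f g h)+
  have closed: "?f \<in> carrier C \<rightarrow>\<^sub>E carrier Q" "?g \<in> carrier C \<rightarrow>\<^sub>E carrier Q"
    using f g hg fh by (auto intro!: Q.meet_closed)
  have r: "conv C Q ?f ?g x \<in> carrier Q"
    using conv_closed[OF closed] x by (rule value_closed)
  have hx: "h x \<in> carrier Q"
    using h x by (rule value_closed)
  have bound: "h x \<sqinter>\<^bsub>Q\<^esub> (f y \<cdot>\<^bsub>Q\<^esub> g z) \<sqsubseteq>\<^bsub>Q\<^esub> conv C Q ?f ?g x"
    if y: "y \<in> carrier C" and z: "z \<in> carrier C" and mem: "x \<in> y \<odot>\<^bsub>C\<^esub> z" for y z
  proof -
    note cl = Q.qmult_closed Q.qstar_closed Q.meet_closed value_closed[OF f y] value_closed[OF g z]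
      value_closed[OF hg y] value_closed[OF fh z] hx r
    \<comment> \<open>\<open>solve_left\<close> gives \<open>y \<in> x \<odot> ginv C z\<close>, and
      \<open>conv_star C Q g\<close> has the value \<open>qstar Q (g z)\<close> at
      \<open>ginv C z\<close> because inverses cancel.\<close>
    have le1: "h x \<cdot>\<^bsub>Q\<^esub> qstar Q (g z) \<sqsubseteq>\<^bsub>Q\<^esub> conv C Q h (conv_star C Q g) y"
      using conv_upper[OF h conv_star_closed[OF g] x C.ginv_closed[OF z] C.solve_left[OF mem y z]] z
      by (simp add: conv_star_apply C.ginv_closed C.ginv_ginv)
    have le2: "qstar Q (f y) \<cdot>\<^bsub>Q\<^esub> h x \<sqsubseteq>\<^bsub>Q\<^esub> conv C Q (conv_star C Q f) h z"
      using conv_upper[OF conv_star_closed[OF f] h C.ginv_closed[OF y] x C.solve_right[OF mem y z]] y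
      by (simp add: conv_star_apply C.ginv_closed C.ginv_ginv)
    have meet_mono: "a \<sqinter>\<^bsub>Q\<^esub> b \<sqsubseteq>\<^bsub>Q\<^esub> a \<sqinter>\<^bsub>Q\<^esub> c"
      if "b \<sqsubseteq>\<^bsub>Q\<^esub> c" "a \<in> carrier Q" "b \<in> carrier Q" "c \<in> carrier Q" for a b c
      using that by (meson Q.le_trans Q.meet_closed Q.meet_le Q.meet_left Q.meet_right)
    have "h x \<sqinter>\<^bsub>Q\<^esub> (f y \<cdot>\<^bsub>Q\<^esub> g z) = (f y \<cdot>\<^bsub>Q\<^esub> g z) \<sqinter>\<^bsub>Q\<^esub> h x"
      by (rule meet_comm)
    also have "\<dots> \<sqsubseteq>\<^bsub>Q\<^esub> (f y \<sqinter>\<^bsub>Q\<^esub> (h x \<cdot>\<^bsub>Q\<^esub> qstar Q (g z))) \<cdot>\<^bsub>Q\<^esub>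
        (g z \<sqinter>\<^bsub>Q\<^esub> (qstar Q (f y) \<cdot>\<^bsub>Q\<^esub> h x))"
      by (rule Q.dedekind) (simp_all add: cl)
    \<comment> \<open>The products inside the meets are enlarged to the convolutions bounding them
      in \<open>le1\<close> and \<open>le2\<close>.\<close>
    also have "\<dots> \<sqsubseteq>\<^bsub>Q\<^esub> ?f y \<cdot>\<^bsub>Q\<^esub> ?g z"
      using y z by (auto intro!: Q.qmult_mono meet_mono le1 le2 simp: cl)
    also have "\<dots> \<sqsubseteq>\<^bsub>Q\<^esub> conv C Q ?f ?g x"
      by (rule conv_upper[OF closed y z mem])
    finally show ?thesis
      using y z by (simp add: cl)
  qed
  have sub: "?T \<subseteq> carrier Q"
    by (rule conv_terms_closed[OF f g])
  \<comment> \<open>The meet is commuted because \<open>inf_distrib_sups\<close> has the supremum on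
    the right.\<close>
  have "conv C Q f g x \<sqinter>\<^bsub>Q\<^esub> h x = h x \<sqinter>\<^bsub>Q\<^esub> (\<Squnion>\<^bsub>Q\<^esub>?T)"
    using x by (simp add: conv_def meet_comm)
  also have "\<dots> = \<Squnion>\<^bsub>Q\<^esub>{h x \<sqinter>\<^bsub>Q\<^esub> b | b. b \<in> ?T}"
    using distrib hx sub by (simp only: inf_distrib_sups_def)
  also have "\<dots> \<sqsubseteq>\<^bsub>Q\<^esub> conv C Q ?f ?g x"
  proof -
    have closed: "(\<lambda>b. h x \<sqinter>\<^bsub>Q\<^esub> b) ` ?T \<subseteq> carrier Q"
      by (intro image_subsetI Q.meet_closed hx subsetD[OF sub])
    have "\<forall>t\<in>?T. h x \<sqinter>\<^bsub>Q\<^esub> t \<sqsubseteq>\<^bsub>Q\<^esub> conv C Q ?f ?g x"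
      unfolding ball_conv_terms using bound by simp
    then show ?thesis
      unfolding Setcompr_eq_image Q.sup_le_iff[OF closed r] by (simp only: ball_simps)
  qed
  finally show ?thesis .
qed

theorem theorem9p2:
  fixes C :: "('c, 'm) groupoid_scheme" and Q :: "('q, 'n) inv_quantale_scheme"
  assumes "groupoid C"
    and "dedekind_quantale Q"
    and "inf_distrib_sups Q"
  shows "dedekind_quantale (conv_quantale C Q)
    \<and> inf_distrib_sups (conv_quantale C Q)
    \<and> (\<forall>F. F \<subseteq> carrier (conv_quantale C Q) \<longrightarrow>
          \<Squnion>\<^bsub>conv_quantale C Q\<^esub>F = (\<lambda>x\<in>carrier C. \<Squnion>\<^bsub>Q\<^esub>{f x | f. f \<in> F})
        \<and> \<Sqinter>\<^bsub>conv_quantale C Q\<^esub>F = (\<lambda>x\<in>carrier C. \<Sqinter>\<^bsub>Q\<^esub>{f x | f. f \<in> F}))"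
proof -
  interpret C: groupoid C by fact
  interpret Q: dedekind_quantale Q by fact
  interpret groupoid_convolution C Q ..
  interpret D: inv_quantale "conv_quantale C Q" by (rule conv_inv_quantale)
  have "dedekind_quantale (conv_quantale C Q)"
  proof
    fix f g h
    assume "f \<in> carrier (conv_quantale C Q)" "g \<in> carrier (conv_quantale C Q)"
      "h \<in> carrier (conv_quantale C Q)"
    then have "f \<in> carrier C \<rightarrow>\<^sub>E carrier Q" "g \<in> carrier C \<rightarrow>\<^sub>E carrier Q"
      "h \<in> carrier C \<rightarrow>\<^sub>E carrier Q"
      by (simp_all add: conv_quantale_simps)
    then show "f \<cdot>\<^bsub>conv_quantale C Q\<^esub> g \<sqinter>\<^bsub>conv_quantale C Q\<^esub> h \<sqsubseteq>\<^bsub>conv_quantale C Q\<^esub>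
      (f \<sqinter>\<^bsub>conv_quantale C Q\<^esub> (h \<cdot>\<^bsub>conv_quantale C Q\<^esub> qstar (conv_quantale C Q) g)) \<cdot>\<^bsub>conv_quantale C Q\<^esub>
      (g \<sqinter>\<^bsub>conv_quantale C Q\<^esub> (qstar (conv_quantale C Q) f \<cdot>\<^bsub>conv_quantale C Q\<^esub> h))"
      using conv_dedekind[OF assms]
      by (simp add: conv_quantale_simps meet_conv_quantale conv_closed conv_star_closed)
  qed
  then show ?thesis
    using conv_inf_distrib_sups[OF assms(3)] sup_conv_quantale inf_conv_quantale
    by (simp add: conv_quantale_simps)
qed

end
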